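(* Let $q$ be a prime power, let $n\geq 1$, and let $\pmb\alpha=(\alpha_1,\dots,\alpha_n)$, $\pmb\beta=(\beta_1,\dots,\beta_n)$ be parameters in $\frac1{q-1}\mathbb Z$ which are nondegenerate, i.e. $\beta_i-\alpha_i\notin\mathbb Z$ for every $i=1,\dots,n$. Let $t\in\mathbb F_q\smallsetminus\{0,1\}$. Then $$\sum_{\substack{(x_i)\in(\mathbb F_q\smallsetminus\{0,1\})^n\\ tx_1\cdots x_n=1}}\ \prod_{i=1}^n\omega^{\alpha_i}(-x_i)\,\omega^{\beta_i-\alpha_i}(1-x_i)=-H(\pmb\alpha,\pmb\beta,t).$$
   Context: Let $\omega^{1/(q-1)}$ be a fixed generator of the group of characters $\mathbb F_q^\times\to\mathbb C^\times$; for $\mu\in\frac1{q-1}\mathbb Z$ this defines the character $\omega^\mu$. Let $\Theta$ be a nontrivial additive character of $\mathbb F_q$, and for $\alpha\in\frac1{q-1}\mathbb Z$ let $g(\alpha)=\sum_{x\in\mathbb F_q^\times}\omega^\alpha(x)\Theta(x)$ be the Gauss sum. The period-normalized hypergeometric sum is $$H(\pmb\alpha,\pmb\beta,t)=\frac{-1}{q-1}\sum_{\mu=0}^{q-2}\Bigl(\prod_{i=1}^n\frac{g(\alpha_i+\frac{\mu}{q-1})\,g(-\beta_i-\frac{\mu}{q-1})}{g(\alpha_i-\beta_i)}\Bigr)\omega^{\mu/(q-1)}((-1)^nt),\qquad t\in\mathbb F_q^\times.$$ *)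

theory Defs
  imports Complex_Main "HOL-Library.FuncSet" "HOL-Library.Cardinality"
begin

text \<open>
  The finite field with \<open>q\<close> elements is a type \<open>'a :: {field, finite}\<close>, with \<open>q = CARD('a)\<close>.
  Characters of its multiplicative group are total functions \<open>'a \<Rightarrow> complex\<close>; their value
  at \<open>0\<close> is unconstrained, and only their values at nonzero arguments are meaningful.
\<close>

definition mult_character :: "('a :: field \<Rightarrow> complex) \<Rightarrow> bool" where
  "mult_character \<chi> \<longleftrightarrow>
     (\<forall>x. x \<noteq> 0 \<longrightarrow> \<chi> x \<noteq> 0) \<and> (\<forall>x y. x \<noteq> 0 \<longrightarrow> y \<noteq> 0 \<longrightarrow> \<chi> (x * y) = \<chi> x * \<chi> y)"

definition generates_mult_characters :: "('a :: field \<Rightarrow> complex) \<Rightarrow> bool" where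
  "generates_mult_characters \<chi> \<longleftrightarrow>
     mult_character \<chi> \<and>
     (\<forall>\<psi>. mult_character \<psi> \<longrightarrow> (\<exists>k :: int. \<forall>x. x \<noteq> 0 \<longrightarrow> \<psi> x = \<chi> x powi k))"

definition nontrivial_add_character :: "('a :: field \<Rightarrow> complex) \<Rightarrow> bool" where
  "nontrivial_add_character \<Theta> \<longleftrightarrow>
     (\<forall>x. \<Theta> x \<noteq> 0) \<and> (\<forall>x y. \<Theta> (x + y) = \<Theta> x * \<Theta> y) \<and> (\<exists>x. \<Theta> x \<noteq> 1)"

definition fractions_with_denom :: "nat \<Rightarrow> rat set" where
  "fractions_with_denom m = {of_int k / of_nat m |k :: int. True}"

text \<open>
  In the following, \<open>\<chi>\<close> plays the role of \<open>\<omega>\<^bsup>1/(q-1)\<^esup>\<close>, so that \<open>omega_pow \<chi> \<mu>\<close> is \<open>\<omega>\<^bsup>\<mu>\<^esup>\<close>.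
  For \<open>\<mu> \<in> fractions_with_denom (q - 1)\<close> the product \<open>(q - 1) * \<mu>\<close> is an integer, and the
  floor merely converts its type.
\<close>

definition omega_pow :: "('a :: {field, finite} \<Rightarrow> complex) \<Rightarrow> rat \<Rightarrow> 'a \<Rightarrow> complex" where
  "omega_pow \<chi> \<mu> x = \<chi> x powi \<lfloor>of_nat (CARD('a) - 1) * \<mu>\<rfloor>"

definition gauss_sum ::
    "('a :: {field, finite} \<Rightarrow> complex) \<Rightarrow> ('a \<Rightarrow> complex) \<Rightarrow> rat \<Rightarrow> complex" where
  "gauss_sum \<chi> \<Theta> \<alpha> = (\<Sum>x \<in> UNIV - {0}. omega_pow \<chi> \<alpha> x * \<Theta> x)"

definition hypergeometric_sum ::
    "('a :: {field, finite} \<Rightarrow> complex) \<Rightarrow> ('a \<Rightarrow> complex) \<Rightarrow> nat \<Rightarrow>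
     (nat \<Rightarrow> rat) \<Rightarrow> (nat \<Rightarrow> rat) \<Rightarrow> 'a \<Rightarrow> complex" where
  "hypergeometric_sum \<chi> \<Theta> n \<alpha> \<beta> t =
     (- 1) / of_nat (CARD('a) - 1) *
     (\<Sum>\<mu> = 0..CARD('a) - 2.
        (\<Prod>i = 1..n.
           gauss_sum \<chi> \<Theta> (\<alpha> i + of_nat \<mu> / of_nat (CARD('a) - 1)) *
           gauss_sum \<chi> \<Theta> (- \<beta> i - of_nat \<mu> / of_nat (CARD('a) - 1)) /
           gauss_sum \<chi> \<Theta> (\<alpha> i - \<beta> i)) *
        omega_pow \<chi> (of_nat \<mu> / of_nat (CARD('a) - 1)) ((- 1) ^ n * t))"

end

theory Submission
  imports Defs "HOL-Algebra.Algebraic_Closure_Type"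
begin

text \<open>
  The generating hypothesis makes \<open>\<chi>\<close> injective on nonzero elements, because the group of nonzero
  elements is cyclic and hence has some injective character, which is a power of \<open>\<chi>\<close>. So each
  factor of \<open>H\<close> is a Jacobi sum (nondegeneracy makes \<open>g(\<alpha>\<^sub>i - \<beta>\<^sub>i)\<close> nonzero), which a change of
  variables turns into \<open>\<Sum>\<^sub>v \<omega>\<^bsup>\<alpha>\<^sub>i\<^esup>(-v) \<omega>\<^bsup>\<beta>\<^sub>i - \<alpha>\<^sub>i\<^esup>(1-v) \<omega>\<^bsup>\<mu>/(q-1)\<^esup>(-v)\<close>. After expanding the product over \<open>i\<close>,
  orthogonality of the characters \<open>\<omega>\<^bsup>\<mu>/(q-1)\<^esup>\<close> selects the tuples with \<open>t x\<^sub>1 \<cdots> x\<^sub>n = 1\<close>.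
\<close>

section \<open>Cyclicity of the multiplicative group of a finite field\<close>

lemma finite_field_power_card_minus_1:
  fixes x :: "'a :: {field, finite}"
  assumes "x \<noteq> 0"
  shows "x ^ (CARD('a) - 1) = 1"
proof -
  \<comment> \<open>Multiplication by \<open>x\<close> permutes the nonzero elements, so their
    product is unchanged and can be cancelled.\<close>
  have "(\<Prod>y \<in> UNIV - {0}. x * y) = (\<Prod>y \<in> UNIV - {0 :: 'a}. y)"
    by (rule prod.reindex_bij_witness[of _ "\<lambda>y. y / x" "\<lambda>y. x * y"]) (use assms in auto)
  hence "x ^ card (UNIV - {0 :: 'a}) * (\<Prod>y \<in> UNIV - {0 :: 'a}. y) = (\<Prod>y \<in> UNIV - {0 :: 'a}. y)"
    by (simp add: prod.distrib)
  moreover have "(\<Prod>y \<in> UNIV - {0 :: 'a}. y) \<noteq> 0"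
    by simp
  ultimately show ?thesis
    by (simp add: card_Diff_singleton)
qed

lemma power_mod_exponent:
  fixes x :: "'a :: monoid_mult"
  assumes "x ^ N = 1"
  shows "x ^ (k mod N) = x ^ k"
proof -
  have "x ^ k = x ^ (k mod N + N * (k div N))"
    by (simp only: mod_mult_div_eq)
  thus ?thesis
    by (simp only: power_add power_mult assms power_one mult_1_right)
qed

lemma finite_field_card_gt_1: "CARD('a :: {field, finite}) > 1"
proof -
  have "card {0, 1 :: 'a} \<le> CARD('a)"
    by (intro card_mono) auto
  thus ?thesis by simp
qed

text \<open>Cyclicity comes from HOL-Algebra: the type is viewed as a field record whose nonzero
  carrier elements and powers are the usual ones. Exponents are then reduced modulo q - 1; the q - 1
  remaining powers exhaust q - 1 elements and are therefore distinct.\<close>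

lemma finite_field_has_generator:
  "\<exists>g :: 'a :: {field, finite}. g \<noteq> 0 \<and> bij_betw (\<lambda>i. g ^ i) {..<CARD('a) - 1} (UNIV - {0})"
proof -
  define R where "R = (ring_of_type_algebra :: 'a ring)"
  interpret R: field R
    unfolding R_def by (rule field_from_type_algebra)
  have pow: "x [^]\<^bsub>R\<^esub> i = x ^ i" for x and i :: nat
    by (induction i) (simp_all add: R_def ring_of_type_algebra_def nat_pow_def mult.commute)
  have car: "carrier R - {\<zero>\<^bsub>R\<^esub>} = UNIV - {0}"
    by (simp add: R_def ring_of_type_algebra_def)
  have "\<exists>g \<in> UNIV - {0 :: 'a}. UNIV - {0} = {g ^ i | i :: nat. i \<in> UNIV}"
    using R.finite_field_mult_group_has_gen[OF finite]
    by (simp only: Multiplicative_Group.carrier_mult_of nat_pow_mult_of pow car)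
  then obtain g :: 'a where g0: "g \<noteq> 0" and g: "UNIV - {0} = {g ^ i | i :: nat. i \<in> UNIV}"
    by auto
  have N: "CARD('a) - 1 > 0"
    using finite_field_card_gt_1[where 'a = 'a] by simp
  have "(\<lambda>i. g ^ i) ` {..<CARD('a) - 1} = UNIV - {0}"
  proof (intro equalityI subsetI)
    fix x :: 'a assume "x \<in> UNIV - {0}"
    then obtain i where i: "x = g ^ i"
      using g by auto
    have "x = g ^ (i mod (CARD('a) - 1))"
      using power_mod_exponent[OF finite_field_power_card_minus_1[OF g0]] i by metis
    moreover have "i mod (CARD('a) - 1) \<in> {..<CARD('a) - 1}"
      using N by simp
    ultimately show "x \<in> (\<lambda>i. g ^ i) ` {..<CARD('a) - 1}"
      by (rule image_eqI)
  qed (use g0 in auto)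
  moreover from this have "inj_on (\<lambda>i. g ^ i) {..<CARD('a) - 1}"
    by (intro eq_card_imp_inj_on) (auto simp: card_Diff_singleton)
  ultimately show ?thesis
    using g0 by (auto simp: bij_betw_def)
qed

section \<open>Characters and the vanishing of their sums\<close>

lemma mult_character_mult:
  "mult_character \<chi> \<Longrightarrow> x \<noteq> 0 \<Longrightarrow> y \<noteq> 0 \<Longrightarrow> \<chi> (x * y) = \<chi> x * \<chi> y"
  and mult_character_nonzero: "mult_character \<chi> \<Longrightarrow> x \<noteq> 0 \<Longrightarrow> \<chi> x \<noteq> 0"
  by (auto simp: mult_character_def)

lemma mult_character_1: "mult_character \<chi> \<Longrightarrow> \<chi> 1 = 1"
  using mult_character_mult[of \<chi> 1 1] mult_character_nonzero[of \<chi> 1] by simp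

lemma mult_character_divide:
  assumes "mult_character \<chi>" "x \<noteq> 0" "y \<noteq> 0"
  shows "\<chi> (x / y) = \<chi> x / \<chi> y"
  using mult_character_mult[OF assms(1), of "x / y" y] mult_character_nonzero[OF assms(1,3)] assms(2,3)
  by (simp add: field_simps)

lemma mult_character_power:
  assumes "mult_character \<chi>" "x \<noteq> 0"
  shows "\<chi> (x ^ k) = \<chi> x ^ k"
  using assms by (induction k) (auto simp: mult_character_1 mult_character_mult)

lemma mult_character_prod:
  assumes "mult_character \<chi>" "\<And>i. i \<in> A \<Longrightarrow> f i \<noteq> 0"
  shows "\<chi> (\<Prod>i\<in>A. f i) = (\<Prod>i\<in>A. \<chi> (f i))"
  using assms(2)
  by (induction A rule: infinite_finite_induct)
     (auto simp: mult_character_1[OF assms(1)] mult_character_mult[OF assms(1)])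

lemma mult_character_times:
  "mult_character \<chi> \<Longrightarrow> mult_character \<psi> \<Longrightarrow> mult_character (\<lambda>x. \<chi> x * \<psi> x)"
  by (auto simp: mult_character_def)

lemma mult_character_powi:
  "mult_character \<chi> \<Longrightarrow> mult_character (\<lambda>x. \<chi> x powi k)"
  by (auto simp: mult_character_def power_int_mult_distrib)

text \<open>Replacing \<open>x\<close> by \<open>y * x\<close> permutes the summands but multiplies
  the sum by \<open>\<chi> y\<close>, which differs from 1.\<close>

lemma sum_mult_character_eq_0:
  fixes \<chi> :: "'a :: {field, finite} \<Rightarrow> complex"
  assumes \<chi>: "mult_character \<chi>" and y: "y \<noteq> 0" "\<chi> y \<noteq> 1"
  shows "(\<Sum>x \<in> UNIV - {0}. \<chi> x) = 0"
proof -
  have "(\<Sum>x \<in> UNIV - {0}. \<chi> x) = (\<Sum>x \<in> UNIV - {0}. \<chi> (y * x))"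
    by (rule sum.reindex_bij_witness[of _ "\<lambda>x. y * x" "\<lambda>x. x / y"]) (use y in auto)
  also have "\<dots> = \<chi> y * (\<Sum>x \<in> UNIV - {0}. \<chi> x)"
    unfolding sum_distrib_left using y by (intro sum.cong) (auto simp: mult_character_mult[OF \<chi>])
  finally show ?thesis
    using y by (metis mult_cancel_right1)
qed

lemma nontrivial_add_character_add:
  "nontrivial_add_character \<Theta> \<Longrightarrow> \<Theta> (x + y) = \<Theta> x * \<Theta> y"
  by (auto simp: nontrivial_add_character_def)

lemma nontrivial_add_character_0: "nontrivial_add_character \<Theta> \<Longrightarrow> \<Theta> 0 = 1"
  by (metis add_0 mult_cancel_right1 nontrivial_add_character_def)

lemma sum_add_character_eq_0:
  fixes \<Theta> :: "'a :: {field, finite} \<Rightarrow> complex"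
  assumes \<Theta>: "nontrivial_add_character \<Theta>" and c: "c \<noteq> 0"
  shows "(\<Sum>x \<in> UNIV. \<Theta> (x * c)) = 0"
proof -
  obtain y where y: "\<Theta> y \<noteq> 1"
    using \<Theta> by (auto simp: nontrivial_add_character_def)
  \<comment> \<open>Scaling by \<open>c\<close> permutes the field, which reduces to
    \<open>c = 1\<close>; translation by \<open>y\<close> then multiplies the sum by
    \<open>\<Theta> y\<close>, which is not 1.\<close>
  have scale: "(\<Sum>x \<in> UNIV. \<Theta> (x * c)) = (\<Sum>x \<in> UNIV. \<Theta> x)"
    by (rule sum.reindex_bij_witness[of _ "\<lambda>x. x / c" "\<lambda>x. x * c"]) (use c in auto)
  have "(\<Sum>x \<in> UNIV. \<Theta> x) = (\<Sum>x \<in> UNIV. \<Theta> (y + x))"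
    by (rule sum.reindex_bij_witness[of _ "\<lambda>x. y + x" "\<lambda>x. x - y"]) auto
  also have "\<dots> = \<Theta> y * (\<Sum>x \<in> UNIV. \<Theta> x)"
    by (simp only: nontrivial_add_character_add[OF \<Theta>] sum_distrib_left)
  finally show ?thesis
    using y scale by (metis mult_cancel_right1)
qed

section \<open>Gauss sums and Jacobi sums of general characters\<close>

text \<open>Indexed by the character itself rather than by a rational exponent, so that products and
  inverses of characters can be formed without floors.\<close>

definition character_gauss_sum ::
    "('a :: {field, finite} \<Rightarrow> complex) \<Rightarrow> ('a \<Rightarrow> complex) \<Rightarrow> complex" where
  "character_gauss_sum \<Theta> A = (\<Sum>x \<in> UNIV - {0}. A x * \<Theta> x)"

lemma character_gauss_sum_mult_expand:
  assumes "nontrivial_add_character \<Theta>"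
  shows "character_gauss_sum \<Theta> A * character_gauss_sum \<Theta> B =
    (\<Sum>(x, y) \<in> (UNIV - {0}) \<times> (UNIV - {0}). A x * B y * \<Theta> (x + y))"
  unfolding character_gauss_sum_def sum_product sum.cartesian_product
  by (simp add: nontrivial_add_character_add[OF assms] mult_ac)

text \<open>Grouping the pairs by the ratio of their entries leaves an inner sum of the additive
  character over multiples of one element, which singles out the ratio -1. The formula serves to
  show that Gauss sums of nontrivial characters do not vanish.\<close>

lemma character_gauss_sum_mult_inverse:
  fixes A \<Theta> :: "'a :: {field, finite} \<Rightarrow> complex"
  assumes \<Theta>: "nontrivial_add_character \<Theta>" and A: "mult_character A"
    and z: "z \<noteq> 0" "A z \<noteq> 1"
  shows "character_gauss_sum \<Theta> A * character_gauss_sum \<Theta> (\<lambda>x. inverse (A x)) = A (-1) * of_nat CARD('a)"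
proof -
  \<comment> \<open>The full sum over \<open>y\<close> is q for \<open>x = -1\<close> and 0
    otherwise; the subtracted 1 is the missing term \<open>y = 0\<close>.\<close>
  have inner: "(\<Sum>y \<in> UNIV - {0}. \<Theta> (y * (1 + x))) = (if x = -1 then of_nat CARD('a) else 0) - 1" for x
  proof -
    have "(\<Sum>y \<in> UNIV. \<Theta> (y * (1 + x))) = (if x = -1 then of_nat CARD('a) else 0)"
      using sum_add_character_eq_0[OF \<Theta>, of "1 + x"]
      by (auto simp: nontrivial_add_character_0[OF \<Theta>] add_eq_0_iff)
    thus ?thesis
      by (subst sum_diff1) (auto simp: nontrivial_add_character_0[OF \<Theta>])
  qed
  have "character_gauss_sum \<Theta> A * character_gauss_sum \<Theta> (\<lambda>x. inverse (A x)) =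
      (\<Sum>(x, y) \<in> (UNIV - {0}) \<times> (UNIV - {0}). A x * \<Theta> (y * (1 + x)))"
    unfolding character_gauss_sum_mult_expand[OF \<Theta>]
  proof (rule sum.reindex_bij_witness[of _ "\<lambda>(x, y). (x * y, y)" "\<lambda>(x, y). (x / y, y)"], goal_cases)
    case (5 p)
    obtain x y where p: "p = (x, y)" by force
    from 5 p have xy: "x \<noteq> 0" "y \<noteq> 0" by auto
    hence "y * (1 + x / y) = x + y"
      by (simp add: field_simps)
    thus ?case
      using xy by (simp add: p mult_character_divide[OF A] inverse_eq_divide)
  qed auto
  also have "\<dots> = (\<Sum>x \<in> UNIV - {0}. A x * ((if x = -1 then of_nat CARD('a) else 0) - 1))"
    by (simp add: sum.cartesian_product[symmetric] sum_distrib_left[symmetric] inner)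
  \<comment> \<open>The constant -1 contributes minus the sum of \<open>A\<close>, which is zero
    because \<open>A\<close> is nontrivial.\<close>
  also have "\<dots> = (\<Sum>x \<in> UNIV - {0}. if x = -1 then A x * of_nat CARD('a) else 0) - (\<Sum>x \<in> UNIV - {0}. A x)"
    unfolding sum_subtractf[symmetric] by (intro sum.cong) (auto simp: algebra_simps)
  also have "\<dots> = A (-1) * of_nat CARD('a)"
    by (simp add: sum_mult_character_eq_0[OF A z] sum.delta)
  finally show ?thesis .
qed

text \<open>The product with the Gauss sum of the inverse character is \<open>A (-1)\<close> times
  q, a nonzero number. This is what permits division by the denominators of H.\<close>

lemma character_gauss_sum_nonzero:
  fixes A \<Theta> :: "'a :: {field, finite} \<Rightarrow> complex"
  assumes "nontrivial_add_character \<Theta>" and A: "mult_character A" and "z \<noteq> 0" "A z \<noteq> 1"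
  shows "character_gauss_sum \<Theta> A \<noteq> 0"
  using character_gauss_sum_mult_inverse[OF assms] mult_character_nonzero[OF A, of "-1"] by auto

text \<open>
  The sum on the right is the Jacobi sum of \<open>A\<close> and \<open>B\<close> after the substitution \<open>x = - v / (1 - v)\<close>.
\<close>

lemma character_gauss_sum_mult:
  fixes A B \<Theta> :: "'a :: {field, finite} \<Rightarrow> complex"
  assumes \<Theta>: "nontrivial_add_character \<Theta>" and A: "mult_character A" and B: "mult_character B"
    and z: "z \<noteq> 0" "A z * B z \<noteq> 1"
  shows "character_gauss_sum \<Theta> A * character_gauss_sum \<Theta> B =
    (\<Sum>v \<in> UNIV - {0, 1}. A (- v) / (A (1 - v) * B (1 - v))) * character_gauss_sum \<Theta> (\<lambda>x. A x * B x)"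
proof -
  let ?S = "(UNIV - {0 :: 'a}) \<times> (UNIV - {0 :: 'a})"
  let ?f = "\<lambda>(x, y). A x * B y * \<Theta> (x + y)"
  \<comment> \<open>Pairs with sum zero have additive character value 1 and contribute a multiple of
    the sum of \<open>A x * B x\<close>, which vanishes since the product character is
    nontrivial.\<close>
  have "sum ?f ?S = sum ?f (?S \<inter> {p. fst p + snd p = 0}) + sum ?f (?S \<inter> - {p. fst p + snd p = 0})"
    by (intro sum.Int_Diff[of _ _ "{p. fst p + snd p = 0}", unfolded Diff_eq]) auto
  also have "sum ?f (?S \<inter> {p. fst p + snd p = 0}) = (\<Sum>x \<in> UNIV - {0}. A x * B (- x))"
    by (rule sum.reindex_bij_witness[of _ "\<lambda>x. (x, - x)" fst])
       (auto simp: nontrivial_add_character_0[OF \<Theta>] dest: minus_unique)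
  also have "\<dots> = B (-1) * (\<Sum>x \<in> UNIV - {0}. A x * B x)"
    unfolding sum_distrib_left
  proof (intro sum.cong refl)
    fix x :: 'a assume "x \<in> UNIV - {0}"
    hence "B (- x) = B (-1) * B x"
      using mult_character_mult[OF B, of "-1" x] by simp
    thus "A x * B (- x) = B (-1) * (A x * B x)"
      by (simp only: mult_ac)
  qed
  also have "(\<Sum>x \<in> UNIV - {0}. A x * B x) = 0"
    by (rule sum_mult_character_eq_0[OF mult_character_times[OF A B] z])
  \<comment> \<open>The remaining pairs are parametrized by \<open>s = x + y\<close> and
    \<open>v = - x / y\<close>. Here \<open>v \<noteq> 0\<close> encodes
    \<open>x \<noteq> 0\<close>, and \<open>v \<noteq> 1\<close> encodes
    \<open>x + y \<noteq> 0\<close>. The summand separates, and its part in \<open>s\<close> sums to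
    the Gauss sum of the product character.\<close>
  also have "sum ?f (?S \<inter> - {p. fst p + snd p = 0}) =
      (\<Sum>(v, s) \<in> (UNIV - {0, 1}) \<times> (UNIV - {0}). A (- v) / (A (1 - v) * B (1 - v)) * (A s * B s * \<Theta> s))"
  proof (rule sum.reindex_bij_witness[of _ "\<lambda>(v, s). (s * (- v / (1 - v)), s / (1 - v))" "\<lambda>(x, y). (- x / y, x + y)"],
      goal_cases)
    case (1 p)
    obtain x y where p: "p = (x, y)" by force
    from 1 p have xy: "y \<noteq> 0" "x + y \<noteq> 0" by auto
    have "1 - (- x / y) = (x + y) / y"
      using xy by (simp add: add_divide_distrib)
    thus ?case
      using xy by (simp add: p)
  next
    case (2 p)
    obtain x y where p: "p = (x, y)" by force
    from 2 p have xy: "x \<noteq> 0" "y \<noteq> 0" "x + y \<noteq> 0" by auto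
    have "1 - (- x / y) = (x + y) / y"
      using xy by (simp add: add_divide_distrib)
    also have "\<dots> \<noteq> 0"
      using xy by simp
    finally have "- x / y \<noteq> 1"
      by (metis diff_self)
    thus ?case
      using xy by (simp add: p)
  next
    case (3 p)
    obtain v s where p: "p = (v, s)" by force
    from 3 p have vs: "1 - v \<noteq> 0" "s \<noteq> 0" by auto
    have "s * (- v / (1 - v)) + s / (1 - v) = s * (1 - v) / (1 - v)"
      by (simp only: right_diff_distrib diff_divide_distrib) simp
    also have "\<dots> = s"
      by (rule nonzero_mult_div_cancel_right[OF vs(1)])
    finally have "s * (- v / (1 - v)) + s / (1 - v) = s" .
    thus ?case
      using vs by (simp add: p)
  next
    case (4 p)
    obtain v s where p: "p = (v, s)" by force
    from 4 p have vs: "1 - v \<noteq> 0" "v \<noteq> 0" "s \<noteq> 0" by auto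
    have "s * (- v / (1 - v)) + s / (1 - v) = s * (1 - v) / (1 - v)"
      by (simp only: right_diff_distrib diff_divide_distrib) simp
    also have "\<dots> = s"
      by (rule nonzero_mult_div_cancel_right[OF vs(1)])
    finally have "s * (- v / (1 - v)) + s / (1 - v) = s" .
    thus ?case
      using vs by (simp add: p)
  next
    case (5 p)
    obtain x y where p: "p = (x, y)" by force
    from 5 p have xy: "x \<noteq> 0" "y \<noteq> 0" "x + y \<noteq> 0" by auto
    have "1 - (- x / y) = (x + y) / y" "- (- x / y) = x / y"
      using xy by (simp_all add: add_divide_distrib)
    thus ?case
      using xy mult_character_nonzero[OF A] mult_character_nonzero[OF B]
      by (simp add: p mult_character_divide[OF A] mult_character_divide[OF B])
  qed
  also have "\<dots> = (\<Sum>v \<in> UNIV - {0, 1}. A (- v) / (A (1 - v) * B (1 - v))) * character_gauss_sum \<Theta> (\<lambda>x. A x * B x)"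
    unfolding character_gauss_sum_def sum_product sum.cartesian_product ..
  finally show ?thesis
    by (simp add: character_gauss_sum_mult_expand[OF \<Theta>])
qed

section \<open>Injectivity and orthogonality of a generating character\<close>

lemma mult_character_root_of_unity:
  fixes \<chi> :: "'a :: {field, finite} \<Rightarrow> complex"
  assumes "mult_character \<chi>" "x \<noteq> 0"
  shows "\<chi> x ^ (CARD('a) - 1) = 1"
  using mult_character_power[OF assms, of "CARD('a) - 1"] mult_character_1[OF assms(1)]
    finite_field_power_card_minus_1[OF assms(2)] by simp

text \<open>The character is the discrete logarithm to a generator \<open>g\<close>, followed by the
  enumeration of the complex (q - 1)-st roots of unity by their exponents; both maps are
  bijective.\<close>

lemma primitive_mult_character_exists:
  obtains \<psi> :: "'a :: {field, finite} \<Rightarrow> complex"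
  where "mult_character \<psi>" "inj_on \<psi> (UNIV - {0})"
proof -
  define N where "N = CARD('a) - 1"
  have N: "N > 0"
    using finite_field_card_gt_1[where 'a = 'a] by (simp add: N_def)
  obtain g :: 'a where g: "g \<noteq> 0" "bij_betw (\<lambda>i. g ^ i) {..<N} (UNIV - {0})"
    using finite_field_has_generator unfolding N_def by blast
  define dlog where "dlog = the_inv_into {..<N} (\<lambda>i. g ^ i)"
  define \<zeta> where "\<zeta> = (\<lambda>k :: nat. cis (2 * pi * k / N))"
  define \<psi> where "\<psi> = \<zeta> \<circ> dlog"
  have \<zeta>: "bij_betw \<zeta> {..<N} {z. z ^ N = 1}"
    unfolding \<zeta>_def using bij_betw_roots_unity[OF N] by simp
  have \<zeta>_add: "\<zeta> (i + j) = \<zeta> i * \<zeta> j" for i j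
    by (simp add: \<zeta>_def cis_mult add_divide_distrib distrib_left)
  \<comment> \<open>The discrete logarithm turns products into sums only modulo \<open>N\<close>, so
    the multiplicativity of \<open>\<psi>\<close> rests on this periodicity.\<close>
  have \<zeta>_mod: "\<zeta> (i mod N) = \<zeta> i" for i
  proof -
    have "2 * pi * real (N * (i div N)) / real N = 2 * pi * real (i div N)"
      using N by simp
    hence "\<zeta> (N * (i div N)) = cis (2 * pi * real (i div N))"
      by (simp only: \<zeta>_def)
    also have "\<dots> = 1"
      by (rule cis_multiple_2pi) auto
    finally show ?thesis
      using \<zeta>_add[of "i mod N" "N * (i div N)"] by simp
  qed
  have gpow: "g ^ (i mod N) = g ^ i" for i
    unfolding N_def by (intro power_mod_exponent finite_field_power_card_minus_1 g(1))
  have dlog: "bij_betw dlog (UNIV - {0}) {..<N}"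
    unfolding dlog_def by (rule bij_betw_the_inv_into[OF g(2)])
  have dlog_pow: "dlog (g ^ i) = i mod N" for i
    using the_inv_into_f_f[OF bij_betw_imp_inj_on[OF g(2)], of "i mod N"] N gpow[of i]
    by (simp add: dlog_def)
  have pow_dlog: "g ^ dlog x = x" if "x \<noteq> 0" for x
    unfolding dlog_def using f_the_inv_into_f_bij_betw[OF g(2)] that by simp
  have "mult_character \<psi>"
    unfolding mult_character_def
  proof (intro conjI allI impI)
    fix x y :: 'a assume "x \<noteq> 0" "y \<noteq> 0"
    hence "dlog (x * y) = (dlog x + dlog y) mod N"
      using dlog_pow[of "dlog x + dlog y"] by (simp add: power_add pow_dlog)
    thus "\<psi> (x * y) = \<psi> x * \<psi> y"
      by (simp add: \<psi>_def \<zeta>_mod \<zeta>_add)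
  qed (simp add: \<psi>_def \<zeta>_def)
  moreover have "inj_on \<psi> (UNIV - {0})"
    unfolding \<psi>_def using bij_betw_trans[OF dlog \<zeta>] by (rule bij_betw_imp_inj_on)
  ultimately show ?thesis by (rule that)
qed

text \<open>An injective character is a power of \<open>\<chi>\<close>, hence takes the value 1
  wherever \<open>\<chi>\<close> does; injectivity leaves only \<open>x = 1\<close>.\<close>

lemma generating_character_eq_1_iff:
  fixes \<chi> :: "'a :: {field, finite} \<Rightarrow> complex"
  assumes "generates_mult_characters \<chi>" "x \<noteq> 0"
  shows "\<chi> x = 1 \<longleftrightarrow> x = 1"
proof
  assume x: "\<chi> x = 1"
  obtain \<psi> :: "'a \<Rightarrow> complex" where \<psi>: "mult_character \<psi>" "inj_on \<psi> (UNIV - {0})"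
    by (rule primitive_mult_character_exists)
  then obtain k where "\<And>y. y \<noteq> 0 \<Longrightarrow> \<psi> y = \<chi> y powi k"
    using assms(1) unfolding generates_mult_characters_def by blast
  hence "\<psi> x = \<psi> 1"
    using x assms(2) mult_character_1[OF \<psi>(1)] by simp
  thus "x = 1"
    using \<psi>(2) assms(2) by (auto dest: inj_onD)
next
  assume "x = 1"
  thus "\<chi> x = 1"
    using mult_character_1[of \<chi>] assms(1) by (simp add: generates_mult_characters_def)
qed

text \<open>The witness is a generator \<open>g\<close>: modulo q - 1 the exponent reduces to some
  \<open>r\<close> strictly between 0 and q - 1, so \<open>g ^ r\<close> differs from 1 and so does
  its value under \<open>\<chi>\<close>. This converts nondegeneracy of the parameters into
  nontriviality of a character.\<close>

lemma generating_character_powi_nontrivial: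
  fixes \<chi> :: "'a :: {field, finite} \<Rightarrow> complex"
  assumes \<chi>: "generates_mult_characters \<chi>" and k: "\<not> int (CARD('a) - 1) dvd k"
  obtains z where "z \<noteq> 0" "\<chi> z powi k \<noteq> 1"
proof -
  define N where "N = CARD('a) - 1"
  have N: "N > 0"
    using finite_field_card_gt_1[where 'a = 'a] by (simp add: N_def)
  have char: "mult_character \<chi>"
    using \<chi> by (simp add: generates_mult_characters_def)
  obtain g :: 'a where g: "g \<noteq> 0" "bij_betw (\<lambda>i. g ^ i) {..<N} (UNIV - {0})"
    using finite_field_has_generator unfolding N_def by blast
  define r where "r = nat (k mod int N)"
  have int_r: "int r = k mod int N"
    using N by (simp add: r_def)
  have "k mod int N \<noteq> 0"
    using k unfolding N_def dvd_eq_mod_eq_0 .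
  hence "int r \<noteq> 0"
    by (simp only: int_r not_False_eq_True)
  moreover have "int r < int N"
    using N unfolding int_r by simp
  moreover have "k = int N * (k div int N) + int r"
    unfolding int_r by simp
  ultimately have r: "0 < r" "r < N" "k = int N * (k div int N) + int r"
    by simp_all
  have root: "\<chi> g ^ N = 1"
    unfolding N_def by (rule mult_character_root_of_unity[OF char g(1)])
  have "\<chi> g powi k = \<chi> (g ^ r)"
    using mult_character_nonzero[OF char g(1)]
    by (subst r(3)) (simp only: power_int_add power_int_mult root power_int_1_left mult_1
        power_int_of_nat mult_character_power[OF char g(1)] simp_thms)
  moreover have "g ^ r \<noteq> g ^ 0"
    using inj_onD[OF bij_betw_imp_inj_on[OF g(2)], of r 0] r(1,2) by auto
  ultimately have "\<chi> g powi k \<noteq> 1"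
    using generating_character_eq_1_iff[OF \<chi>, of "g ^ r"] g(1) by simp
  with g(1) show ?thesis
    by (rule that)
qed

text \<open>For \<open>x \<noteq> 1\<close>, \<open>\<chi> x\<close> is a (q - 1)-st root of unity
  different from 1, so the geometric sum vanishes.\<close>

lemma generating_character_orthogonality:
  fixes \<chi> :: "'a :: {field, finite} \<Rightarrow> complex"
  assumes \<chi>: "generates_mult_characters \<chi>" and x: "x \<noteq> 0"
  shows "(\<Sum>m<CARD('a) - 1. \<chi> x ^ m) = (if x = 1 then of_nat (CARD('a) - 1) else 0)"
proof (cases "x = 1")
  case False
  hence "\<chi> x \<noteq> 1"
    using generating_character_eq_1_iff[OF \<chi> x] by simp
  moreover have "\<chi> x ^ (CARD('a) - 1) = 1"
    using mult_character_root_of_unity[OF _ x] \<chi> by (auto simp: generates_mult_characters_def)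
  ultimately show ?thesis
    using False by (simp add: sum_gp_strict)
qed (use generating_character_eq_1_iff[OF \<chi> x] in simp)

section \<open>From rational parameters to integer exponents\<close>

text \<open>Since q - 1 is positive it cancels, and the floor in \<open>omega_pow\<close> returns
  the integer \<open>k\<close> exactly.\<close>

lemma omega_pow_divide:
  fixes \<chi> :: "'a :: {field, finite} \<Rightarrow> complex"
  shows "omega_pow \<chi> (of_int k / of_nat (CARD('a) - 1)) x = \<chi> x powi k"
  using finite_field_card_gt_1[where 'a = 'a] by (simp add: omega_pow_def)

lemma gauss_sum_divide:
  fixes \<chi> \<Theta> :: "'a :: {field, finite} \<Rightarrow> complex"
  shows "gauss_sum \<chi> \<Theta> (of_int k / of_nat (CARD('a) - 1)) = character_gauss_sum \<Theta> (\<lambda>x. \<chi> x powi k)"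
  by (simp only: gauss_sum_def character_gauss_sum_def omega_pow_divide)

text \<open>Evaluates one factor of H, with \<open>a\<close>, \<open>b\<close> the numerators of the
  parameters and \<open>m\<close> the summation index. The exponents \<open>a + m\<close> and
  \<open>- b - m\<close> add up to \<open>a - b\<close> for every \<open>m\<close>, so the Gauss sum
  of the product character is exactly the denominator. The dependence on \<open>m\<close> is
  isolated in the last power.\<close>

lemma gauss_sum_ratio:
  fixes \<chi> \<Theta> :: "'a :: {field, finite} \<Rightarrow> complex" and a b m :: int
  assumes \<chi>: "generates_mult_characters \<chi>" and \<Theta>: "nontrivial_add_character \<Theta>"
    and ab: "\<not> int (CARD('a) - 1) dvd a - b"
  shows "character_gauss_sum \<Theta> (\<lambda>x. \<chi> x powi (a + m)) * character_gauss_sum \<Theta> (\<lambda>x. \<chi> x powi (- b - m)) /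
      character_gauss_sum \<Theta> (\<lambda>x. \<chi> x powi (a - b)) =
    (\<Sum>v \<in> UNIV - {0, 1}. \<chi> (- v) powi a * \<chi> (1 - v) powi (b - a) * \<chi> (- v) powi m)"
proof -
  have char: "mult_character \<chi>"
    using \<chi> by (simp add: generates_mult_characters_def)
  obtain z where z: "z \<noteq> 0" "\<chi> z powi (a - b) \<noteq> 1"
    using generating_character_powi_nontrivial[OF \<chi> ab] .
  have pow: "\<chi> x powi (a + m) * \<chi> x powi (- b - m) = \<chi> x powi (a - b)" if "x \<noteq> 0" for x
    using mult_character_nonzero[OF char that] by (simp add: power_int_add[symmetric])
  have "character_gauss_sum \<Theta> (\<lambda>x. \<chi> x powi (a + m)) * character_gauss_sum \<Theta> (\<lambda>x. \<chi> x powi (- b - m)) =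
      (\<Sum>v \<in> UNIV - {0, 1}. \<chi> (- v) powi (a + m) / (\<chi> (1 - v) powi (a + m) * \<chi> (1 - v) powi (- b - m))) *
      character_gauss_sum \<Theta> (\<lambda>x. \<chi> x powi (a + m) * \<chi> x powi (- b - m))"
    using z pow by (intro character_gauss_sum_mult[OF \<Theta>, of _ _ z] mult_character_powi char) auto
  also have "character_gauss_sum \<Theta> (\<lambda>x. \<chi> x powi (a + m) * \<chi> x powi (- b - m)) =
      character_gauss_sum \<Theta> (\<lambda>x. \<chi> x powi (a - b))"
    unfolding character_gauss_sum_def by (intro sum.cong) (auto simp: pow)
  \<comment> \<open>The two powers of \<open>\<chi> (1 - v)\<close> in the denominator combine to
    the exponent \<open>a - b\<close>, which becomes \<open>b - a\<close> on inversion.\<close>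
  also have "(\<Sum>v \<in> UNIV - {0, 1}. \<chi> (- v) powi (a + m) / (\<chi> (1 - v) powi (a + m) * \<chi> (1 - v) powi (- b - m))) =
      (\<Sum>v \<in> UNIV - {0, 1}. \<chi> (- v) powi a * \<chi> (1 - v) powi (b - a) * \<chi> (- v) powi m)"
  proof (intro sum.cong refl)
    fix v :: 'a assume "v \<in> UNIV - {0, 1}"
    hence nz: "\<chi> (- v) \<noteq> 0" "1 - v \<noteq> 0" "\<chi> (1 - v) \<noteq> 0"
      using mult_character_nonzero[OF char] by auto
    show "\<chi> (- v) powi (a + m) / (\<chi> (1 - v) powi (a + m) * \<chi> (1 - v) powi (- b - m)) =
        \<chi> (- v) powi a * \<chi> (1 - v) powi (b - a) * \<chi> (- v) powi m"
      unfolding pow[OF nz(2)] using nz by (simp add: power_int_add power_int_diff)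
  qed
  finally show ?thesis
    using character_gauss_sum_nonzero[OF \<Theta> mult_character_powi[OF char] z] by simp
qed

section \<open>Expansion of the hypergeometric sum over tuples\<close>

theorem proposition4p5p1:
  fixes \<chi> \<Theta> :: "'a :: {field, finite} \<Rightarrow> complex"
    and n :: nat and \<alpha> \<beta> :: "nat \<Rightarrow> rat" and t :: 'a
  assumes "generates_mult_characters \<chi>"
    and "nontrivial_add_character \<Theta>"
    and "n \<ge> 1"
    and "\<And>i. i \<in> {1..n} \<Longrightarrow> \<alpha> i \<in> fractions_with_denom (CARD('a) - 1)"
    and "\<And>i. i \<in> {1..n} \<Longrightarrow> \<beta> i \<in> fractions_with_denom (CARD('a) - 1)"
    and "\<And>i. i \<in> {1..n} \<Longrightarrow> \<beta> i - \<alpha> i \<notin> \<int>"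
    and "t \<notin> {0, 1}"
  shows "(\<Sum>x \<in> {x \<in> {1..n} \<rightarrow>\<^sub>E (UNIV - {0, 1}). t * (\<Prod>i = 1..n. x i) = 1}.
            \<Prod>i = 1..n. omega_pow \<chi> (\<alpha> i) (- x i) * omega_pow \<chi> (\<beta> i - \<alpha> i) (1 - x i))
         = - hypergeometric_sum \<chi> \<Theta> n \<alpha> \<beta> t"
proof -
  define N where "N = CARD('a) - 1"
  have N: "N > 0"
    using finite_field_card_gt_1[where 'a = 'a] by (simp add: N_def)
  have char: "mult_character \<chi>"
    using assms(1) by (simp add: generates_mult_characters_def)
  have t: "t \<noteq> 0"
    using assms(7) by simp
  have "\<exists>k :: int. \<alpha> i = of_int k / of_nat N" "\<exists>k :: int. \<beta> i = of_int k / of_nat N" if "i \<in> {1..n}" for i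
    using assms(4,5)[OF that] by (auto simp: fractions_with_denom_def N_def)
  then obtain a b :: "nat \<Rightarrow> int"
    where a: "\<And>i. i \<in> {1..n} \<Longrightarrow> \<alpha> i = of_int (a i) / of_nat N"
      and b: "\<And>i. i \<in> {1..n} \<Longrightarrow> \<beta> i = of_int (b i) / of_nat N"
    by metis
  have nd: "\<not> int N dvd a i - b i" if i: "i \<in> {1..n}" for i
  proof
    assume "int N dvd a i - b i"
    then obtain k where "a i - b i = int N * k" ..
    hence k: "b i - a i = int N * (- k)" by simp
    have "\<beta> i - \<alpha> i = of_int (b i - a i) / of_nat N"
      by (simp add: a[OF i] b[OF i] diff_divide_distrib)
    also have "\<dots> = of_int (- k)"
      unfolding k using N by simp
    finally show False
      using assms(6)[OF i] by simp
  qed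
  define S where "S = UNIV - {0, 1 :: 'a}"
  \<comment> \<open>The part of the \<open>i\<close>-th Jacobi summand that is independent of the
    summation index; it is also the \<open>i\<close>-th factor of the left-hand side.\<close>
  define c where "c = (\<lambda>i v. \<chi> (- v) powi a i * \<chi> (1 - v) powi (b i - a i))"
  define P where "P = {1..n} \<rightarrow>\<^sub>E S"
  have finP: "finite P"
    unfolding P_def S_def by (intro finite_PiE) auto
  have factor: "gauss_sum \<chi> \<Theta> (\<alpha> i + of_nat \<mu> / of_nat N) * gauss_sum \<chi> \<Theta> (- \<beta> i - of_nat \<mu> / of_nat N) /
      gauss_sum \<chi> \<Theta> (\<alpha> i - \<beta> i) = (\<Sum>v \<in> S. c i v * \<chi> (- v) ^ \<mu>)" if i: "i \<in> {1..n}" for i \<mu>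
  proof -
    have "\<alpha> i + of_nat \<mu> / of_nat N = of_int (a i + int \<mu>) / of_nat N"
      "- \<beta> i - of_nat \<mu> / of_nat N = of_int (- b i - int \<mu>) / of_nat N"
      "\<alpha> i - \<beta> i = of_int (a i - b i) / of_nat N"
      by (simp_all add: a[OF i] b[OF i] add_divide_distrib diff_divide_distrib)
    thus ?thesis
      using gauss_sum_ratio[OF assms(1,2) nd[OF i, unfolded N_def], of "int \<mu>"]
      by (simp only: N_def gauss_sum_divide S_def c_def power_int_of_nat)
  qed
  have omega: "omega_pow \<chi> (of_nat \<mu> / of_nat N) x = \<chi> x ^ \<mu>" for \<mu> x
    using omega_pow_divide[of \<chi> "int \<mu>" x] by (simp only: N_def of_int_of_nat_eq power_int_of_nat)
  \<comment> \<open>The sign in the argument of H cancels the \<open>n\<close> minus signs of the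
    \<open>- x i\<close>, so the whole dependence on \<open>\<mu>\<close> is a power of
    \<open>\<chi>\<close> at the quantity constrained to be 1.\<close>
  have collect: "(\<Prod>i = 1..n. \<chi> (- x i) ^ \<mu>) * \<chi> ((- 1) ^ n * t) ^ \<mu> = \<chi> (t * (\<Prod>i = 1..n. x i)) ^ \<mu>"
    if x: "x \<in> P" for x \<mu>
  proof -
    have nz: "x i \<noteq> 0" if "i \<in> {1..n}" for i
      using x that by (auto simp: P_def S_def PiE_def Pi_def)
    have "(\<Prod>i = 1..n. \<chi> (- x i)) = \<chi> (\<Prod>i = 1..n. - x i)"
      using nz by (subst mult_character_prod[OF char]) auto
    moreover have "(\<Prod>i = 1..n. - x i) \<noteq> 0"
      using nz by auto
    ultimately have "(\<Prod>i = 1..n. \<chi> (- x i)) * \<chi> ((- 1) ^ n * t) = \<chi> ((\<Prod>i = 1..n. - x i) * ((- 1) ^ n * t))"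
      using t by (subst mult_character_mult[OF char]) auto
    also have "(\<Prod>i = 1..n. - x i) * ((- 1) ^ n * t) = t * (\<Prod>i = 1..n. x i)"
      by (simp add: prod_uminus power_mult_distrib[symmetric])
    finally show ?thesis
      by (simp only: prod_power_distrib[symmetric] power_mult_distrib[symmetric])
  qed
  \<comment> \<open>Since q is at least 2, the truncated subtraction is exact, and the index range
    has \<open>N\<close> elements, a full period for orthogonality.\<close>
  have range: "{0..CARD('a) - 2} = {..<N}"
    using finite_field_card_gt_1[where 'a = 'a] by (auto simp: N_def)
  have "- hypergeometric_sum \<chi> \<Theta> n \<alpha> \<beta> t =
      1 / of_nat N * (\<Sum>\<mu><N. (\<Prod>i = 1..n. \<Sum>v \<in> S. c i v * \<chi> (- v) ^ \<mu>) * \<chi> ((- 1) ^ n * t) ^ \<mu>)"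
    unfolding hypergeometric_sum_def N_def[symmetric] range by (simp add: factor omega)
  also have "(\<Sum>\<mu><N. (\<Prod>i = 1..n. \<Sum>v \<in> S. c i v * \<chi> (- v) ^ \<mu>) * \<chi> ((- 1) ^ n * t) ^ \<mu>) =
      (\<Sum>\<mu><N. \<Sum>x \<in> P. (\<Prod>i = 1..n. c i (x i)) * \<chi> (t * (\<Prod>i = 1..n. x i)) ^ \<mu>)"
  proof (intro sum.cong refl)
    fix \<mu>
    \<comment> \<open>A product of sums becomes a sum over tuples in \<open>P\<close>, one choice of
      \<open>v\<close> for each index \<open>i\<close>.\<close>
    have "(\<Prod>i = 1..n. \<Sum>v \<in> S. c i v * \<chi> (- v) ^ \<mu>) = (\<Sum>x \<in> P. \<Prod>i = 1..n. c i (x i) * \<chi> (- x i) ^ \<mu>)"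
      unfolding P_def by (rule prod_sum_PiE) (auto simp: S_def)
    thus "(\<Prod>i = 1..n. \<Sum>v \<in> S. c i v * \<chi> (- v) ^ \<mu>) * \<chi> ((- 1) ^ n * t) ^ \<mu> =
        (\<Sum>x \<in> P. (\<Prod>i = 1..n. c i (x i)) * \<chi> (t * (\<Prod>i = 1..n. x i)) ^ \<mu>)"
      by (simp only: sum_distrib_right prod.distrib mult.assoc collect cong: sum.cong)
  qed
  also have "\<dots> = (\<Sum>x \<in> P. (\<Prod>i = 1..n. c i (x i)) * (\<Sum>\<mu><N. \<chi> (t * (\<Prod>i = 1..n. x i)) ^ \<mu>))"
    by (subst sum.swap) (simp add: sum_distrib_left)
  \<comment> \<open>Orthogonality leaves the factor \<open>N\<close> on the constrained tuples and 0
    elsewhere; this \<open>N\<close> cancels the normalization of H.\<close>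
  also have "\<dots> = (\<Sum>x \<in> P. if t * (\<Prod>i = 1..n. x i) = 1 then of_nat N * (\<Prod>i = 1..n. c i (x i)) else 0)"
  proof (intro sum.cong refl)
    fix x assume "x \<in> P"
    hence "t * (\<Prod>i = 1..n. x i) \<noteq> 0"
      using t by (auto simp: P_def S_def PiE_def Pi_def)
    from generating_character_orthogonality[OF assms(1) this]
    show "(\<Prod>i = 1..n. c i (x i)) * (\<Sum>\<mu><N. \<chi> (t * (\<Prod>i = 1..n. x i)) ^ \<mu>) =
        (if t * (\<Prod>i = 1..n. x i) = 1 then of_nat N * (\<Prod>i = 1..n. c i (x i)) else 0)"
      by (simp add: N_def)
  qed
  also have "\<dots> = of_nat N * (\<Sum>x \<in> {x \<in> P. t * (\<Prod>i = 1..n. x i) = 1}. \<Prod>i = 1..n. c i (x i))"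
    using finP by (simp add: sum.inter_filter[symmetric] sum_distrib_left)
  also have "(\<Sum>x \<in> {x \<in> P. t * (\<Prod>i = 1..n. x i) = 1}. \<Prod>i = 1..n. c i (x i)) =
      (\<Sum>x \<in> {x \<in> P. t * (\<Prod>i = 1..n. x i) = 1}.
        \<Prod>i = 1..n. omega_pow \<chi> (\<alpha> i) (- x i) * omega_pow \<chi> (\<beta> i - \<alpha> i) (1 - x i))"
  proof (intro sum.cong prod.cong refl)
    fix x i assume i: "i \<in> {1..n}"
    have "\<beta> i - \<alpha> i = of_int (b i - a i) / of_nat N"
      by (simp add: a[OF i] b[OF i] diff_divide_distrib)
    thus "c i (x i) = omega_pow \<chi> (\<alpha> i) (- x i) * omega_pow \<chi> (\<beta> i - \<alpha> i) (1 - x i)"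
      by (simp only: a[OF i] N_def omega_pow_divide c_def)
  qed
  finally show ?thesis
    using N by (simp add: P_def S_def)
qed

end
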